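(* Let $\mathcal{S}$ be any finite nonempty set of points in $\mathbb{E}^2$. If the points of $\mathbb{E}^2$ are colored in finitely many colors (i.e. $\chi:\mathbb{E}^2\to\{1,\ldots,c\}$ is an arbitrary function for some positive integer $c$), then there exists a family of cardinality $2^{\aleph_0}$ of pairwise-disjoint subsets of $\mathbb{E}^2$, each of which is monochromatic and homothetic to $\mathcal{S}$.
   Context: $\mathbb{E}^2$ denotes the Euclidean plane (i.e. $\mathbb{R}^2$). For $\mathcal{X}\subseteq\mathbb{E}^2$, $b\in\mathbb{R}$ and $\mathbf{a}\in\mathbb{E}^2$, $\mathbf{a}+b\mathcal{X}=\{\mathbf{a}+b\mathbf{x}:\mathbf{x}\in\mathcal{X}\}$. A subset of $\mathbb{E}^2$ is homothetic to $\mathcal{S}$ if it is of the form $\mathbf{a}+b\mathcal{S}$ for some $\mathbf{a}\in\mathbb{E}^2$ and some $b\in\mathbb{R}$ with $b\neq 0$. A set is monochromatic if all its points receive the same color. *)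

theory Defs
  imports "HOL-Analysis.Analysis" "HOL-Library.Equipollence"
begin

(* The factor b may be negative; only b = 0 is excluded. *)
definition homothetic :: "(real^2) set \<Rightarrow> (real^2) set \<Rightarrow> bool" where
  "homothetic X S \<longleftrightarrow> (\<exists>(a :: real^2) (b :: real). b \<noteq> 0 \<and> X = (\<lambda>x. a + b *\<^sub>R x) ` S)"

definition monochromatic :: "(real^2 \<Rightarrow> nat) \<Rightarrow> (real^2) set \<Rightarrow> bool" where
  "monochromatic f X \<longleftrightarrow> (\<forall>x\<in>X. \<forall>y\<in>X. f x = f y)"

end

theory Submission
  imports Defs
begin

text \<open>Gallai's theorem is proved by induction on \<open>S\<close> with colour focusing, in the form that finitely
  many homotheties, chosen independently of the colouring, suffice. Hence there is a finite set
  \<open>T\<close> every translate of which contains a monochromatic homothetic copy of \<open>S\<close>. Translating \<open>T\<close>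
  along a segment shorter than every nonzero difference of points of \<open>T\<close> yields continuum many
  disjoint translates.\<close>

text \<open>\<open>D\<close> is quantified before the colouring \<open>f\<close>: this uniformity
  keeps the windows of the induction finite. Demanding \<open>b > 0\<close> rather than
  \<open>b \<noteq> 0\<close> makes scale factors closed under addition.\<close>

definition gallai :: "'a::real_vector set \<Rightarrow> bool" where
  "gallai S \<longleftrightarrow> (\<forall>c. \<exists>D :: ('a \<times> real) set. finite D \<and> (\<forall>(a, b)\<in>D. b > 0) \<and>
     (\<forall>f. f \<in> UNIV \<rightarrow> {..<c::nat} \<longrightarrow> (\<exists>(a, b)\<in>D. \<exists>k. \<forall>x\<in>S. f (a + b *\<^sub>R x) = k)))"

text \<open>Numbering the colours by a bijection allows any finite colour type, in particular
  functions on a window as colours.\<close>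

lemma gallai_finite_colours:
  fixes S :: "'a::real_vector set" and C :: "'b set"
  assumes "gallai S" "finite C"
  obtains D where "finite D" "\<And>a b. (a, b) \<in> D \<Longrightarrow> b > 0"
    "\<And>F. F \<in> UNIV \<rightarrow> C \<Longrightarrow> \<exists>a b k. (a, b) \<in> D \<and> (\<forall>x\<in>S. F (a + b *\<^sub>R x) = k)"
proof -
  obtain h where h: "bij_betw h C {..<card C}"
    using assms(2) ex_bij_betw_finite_nat[of C] by (auto simp: atLeast0LessThan)
  from assms(1) obtain D where D: "finite D" "\<forall>(a, b)\<in>D. b > 0"
    "\<And>f. f \<in> UNIV \<rightarrow> {..<card C} \<Longrightarrow> \<exists>(a, b)\<in>D. \<exists>k. \<forall>x\<in>S. f (a + b *\<^sub>R x) = k"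
    unfolding gallai_def by meson
  show ?thesis
  proof
    fix F :: "'a \<Rightarrow> 'b" assume F: "F \<in> UNIV \<rightarrow> C"
    then have "h \<circ> F \<in> UNIV \<rightarrow> {..<card C}"
      using bij_betwE[OF h] by auto
    then obtain a b k where ab: "(a, b) \<in> D" "\<forall>x\<in>S. h (F (a + b *\<^sub>R x)) = k"
      using D(3)[of "h \<circ> F"] by auto
    then have "\<forall>x\<in>S. F (a + b *\<^sub>R x) = inv_into C h k"
      using h F by (metis Pi_iff UNIV_I bij_betw_inv_into_left)
    with ab(1) show "\<exists>a b k. (a, b) \<in> D \<and> (\<forall>x\<in>S. F (a + b *\<^sub>R x) = k)"
      by blast
  qed (use D in auto)
qed

definition copy_in :: "('a::real_vector \<Rightarrow> nat) \<Rightarrow> 'a set \<Rightarrow> 'a set \<Rightarrow> nat \<Rightarrow> 'a \<times> real \<Rightarrow> bool" where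
  "copy_in f W S k = (\<lambda>(a, b). \<forall>x\<in>S. a + b *\<^sub>R x \<in> W \<and> f (a + b *\<^sub>R x) = k)"

lemma copy_in_Pair:
  "copy_in f W S k (a, b) \<longleftrightarrow> (\<forall>x\<in>S. a + b *\<^sub>R x \<in> W \<and> f (a + b *\<^sub>R x) = k)"
  by (simp add: copy_in_def)

text \<open>The focus \<open>p\<close> is where every one of the copies would place the missing
  point \<open>s\<close>. Since \<open>p\<close> lies in \<open>W\<close>, a copy whose colour is
  that of \<open>p\<close> extends to \<open>insert s S\<close> inside \<open>W\<close>.\<close>

definition focused ::
  "('a::real_vector \<Rightarrow> nat) \<Rightarrow> 'a set \<Rightarrow> ('a \<times> real) set \<Rightarrow> 'a set \<Rightarrow> 'a \<Rightarrow> 'a \<Rightarrow> nat set \<Rightarrow> bool" where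
  "focused f W D S s p K \<longleftrightarrow> p \<in> W \<and>
     (\<forall>k\<in>K. \<exists>(a, b)\<in>D. a + b *\<^sub>R s = p \<and> copy_in f W S k (a, b))"

definition focusing :: "'a::real_vector set \<Rightarrow> 'a \<Rightarrow> nat \<Rightarrow> nat \<Rightarrow> 'a set \<Rightarrow> ('a \<times> real) set \<Rightarrow> bool" where
  "focusing S s c r W D \<longleftrightarrow> finite W \<and> finite D \<and> (\<forall>(a, b)\<in>D. b > 0) \<and>
     (\<forall>f. f \<in> UNIV \<rightarrow> {..<c} \<longrightarrow>
        (\<exists>ab\<in>D. \<exists>k. copy_in f W (insert s S) k ab) \<or>
        (\<exists>p K. K \<subseteq> {..<c} \<and> card K = r \<and> focused f W D S s p K))"

text \<open>Colour each point by the colour pattern of the translate of \<open>W\<close> based there. A copy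
  \<open>a + b S\<close> that is monochromatic in these patterns thickens every focused copy in \<open>W\<close> to one
  in \<open>W'\<close> with a common new focus, and the translates of the old focus contribute one more colour.\<close>

lemma focusing_step:
  fixes S :: "'a::real_vector set"
  assumes gal: "gallai S" and S: "finite S" "x0 \<in> S" and foc: "focusing S s c r W D"
  shows "\<exists>W' D'. focusing S s c (Suc r) W' D'"
proof -
  have W: "finite W" and D: "finite D" "\<And>a b. (a, b) \<in> D \<Longrightarrow> b > 0"
    and alt: "\<And>f. f \<in> UNIV \<rightarrow> {..<c} \<Longrightarrow>
        (\<exists>ab\<in>D. \<exists>k. copy_in f W (insert s S) k ab) \<or>
        (\<exists>p K. K \<subseteq> {..<c} \<and> card K = r \<and> focused f W D S s p K)"
    using foc unfolding focusing_def by auto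
  obtain E where E: "finite E" "\<And>a b. (a, b) \<in> E \<Longrightarrow> b > 0"
    and mono: "\<And>F. F \<in> UNIV \<rightarrow> (W \<rightarrow>\<^sub>E {..<c}) \<Longrightarrow>
      \<exists>a b k. (a, b) \<in> E \<and> (\<forall>x\<in>S. F (a + b *\<^sub>R x) = k)"
    using gallai_finite_colours[OF gal, of "W \<rightarrow>\<^sub>E {..<c}"] W by (metis finite_PiE finite_lessThan)
  \<comment> \<open>One translate of \<open>W\<close> at each point of each copy of
    \<open>insert s S\<close>; those at the images of \<open>s\<close> house the new focus.\<close>
  define W' where "W' = (\<lambda>((a, b), x, t). a + b *\<^sub>R x + t) ` (E \<times> insert s S \<times> W)"
  \<comment> \<open>The three families: copies inside one translate of \<open>W\<close>, thickened
    copies with summed shifts and scales, and copies traced by the old focus.\<close>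
  define D' where "D' = (\<lambda>((a, b), (a', b')). (a + b *\<^sub>R x0 + a', b')) ` (E \<times> D)
    \<union> (\<lambda>((a, b), (a', b')). (a + a', b + b')) ` (E \<times> D)
    \<union> (\<lambda>((a, b), p). (a + p, b)) ` (E \<times> W)"
  have W'I: "a + b *\<^sub>R x + t \<in> W'" if "(a, b) \<in> E" "x \<in> insert s S" "t \<in> W" for a b x t
    unfolding W'_def using that by (intro image_eqI[of _ _ "((a, b), x, t)"]) auto
  have D'1: "(a + b *\<^sub>R x0 + a', b') \<in> D'" and D'2: "(a + a', b + b') \<in> D'"
    if "(a, b) \<in> E" "(a', b') \<in> D" for a b a' b'
    unfolding D'_def using that by (force intro: image_eqI[of _ _ "((a, b), (a', b'))"])+
  have D'3: "(a + p, b) \<in> D'" if "(a, b) \<in> E" "p \<in> W" for a b p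
    unfolding D'_def using that by (force intro: image_eqI[of _ _ "((a, b), p)"])
  have "focusing S s c (Suc r) W' D'"
    unfolding focusing_def
  proof (intro conjI allI impI)
    show "finite W'" "finite D'"
      unfolding W'_def D'_def using W D(1) E(1) S(1) by auto
    show "\<forall>(a, b)\<in>D'. b > 0"
      unfolding D'_def using D(2) E(2) by (auto simp: add_pos_pos)
  next
    fix f :: "'a \<Rightarrow> nat" assume f: "f \<in> UNIV \<rightarrow> {..<c}"
    have "(\<lambda>y. \<lambda>t\<in>W. f (y + t)) \<in> UNIV \<rightarrow> (W \<rightarrow>\<^sub>E {..<c})"
      using f by auto
    from mono[OF this] obtain a b h where ab: "(a, b) \<in> E"
      and h: "\<And>x. x \<in> S \<Longrightarrow> (\<lambda>t\<in>W. f (a + b *\<^sub>R x + t)) = h" by blast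
    \<comment> \<open>The common pattern, read at the reference point \<open>x0\<close> and extended
      to a colouring of the whole space so that \<open>alt\<close> applies.\<close>
    define g where "g t = f (a + b *\<^sub>R x0 + t)" for t
    have g: "f (a + b *\<^sub>R x + t) = g t" if "x \<in> S" "t \<in> W" for x t
      using h[OF that(1)] h[OF S(2)] that(2) unfolding g_def by (metis restrict_apply')
    have gc: "g \<in> UNIV \<rightarrow> {..<c}"
      using f unfolding g_def by auto
    have full: "\<exists>ab\<in>D'. \<exists>k. copy_in f W' (insert s S) k ab"
      if "(a', b') \<in> D" "copy_in g W (insert s S) k (a', b')" for a' b' k
    proof (intro bexI exI)
      show "(a + b *\<^sub>R x0 + a', b') \<in> D'"
        using D'1 ab that(1) by blast
      show "copy_in f W' (insert s S) k (a + b *\<^sub>R x0 + a', b')"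
        unfolding copy_in_Pair
      proof
        fix x assume x: "x \<in> insert s S"
        have *: "a + b *\<^sub>R x0 + a' + b' *\<^sub>R x = a + b *\<^sub>R x0 + (a' + b' *\<^sub>R x)" by simp
        show "a + b *\<^sub>R x0 + a' + b' *\<^sub>R x \<in> W' \<and> f (a + b *\<^sub>R x0 + a' + b' *\<^sub>R x) = k"
          unfolding * using that(2) x W'I[OF ab] S(2) g by (auto simp: copy_in_Pair)
      qed
    qed
    from alt[OF gc] show "(\<exists>ab\<in>D'. \<exists>k. copy_in f W' (insert s S) k ab) \<or>
        (\<exists>p K. K \<subseteq> {..<c} \<and> card K = Suc r \<and> focused f W' D' S s p K)"
    proof (elim disjE exE conjE)
      assume "\<exists>ab\<in>D. \<exists>k. copy_in g W (insert s S) k ab"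
      then show ?thesis using full by auto
    next
      fix p K assume K: "K \<subseteq> {..<c}" "card K = r" and foc: "focused g W D S s p K"
      then have p: "p \<in> W" by (simp add: focused_def)
      show ?thesis
      \<comment> \<open>If the colour of the focus is already present, the copy of that colour is
        completed by the focus; otherwise it is a new colour for the shifted focus.\<close>
      proof (cases "g p \<in> K")
        case True
        then obtain a' b' where "(a', b') \<in> D" "a' + b' *\<^sub>R s = p" "copy_in g W S (g p) (a', b')"
          using foc unfolding focused_def by blast
        then have "copy_in g W (insert s S) (g p) (a', b')"
          using p by (simp add: copy_in_Pair)
        with \<open>(a', b') \<in> D\<close> show ?thesis using full by blast
      next
        case False
        have "focused f W' D' S s (a + b *\<^sub>R s + p) (insert (g p) K)"
          unfolding focused_def
        proof (intro conjI ballI)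
          show "a + b *\<^sub>R s + p \<in> W'" using W'I ab p by blast
        next
          fix k assume "k \<in> insert (g p) K"
          then consider "k = g p" | "k \<in> K" by blast
          then show "\<exists>(a', b')\<in>D'. a' + b' *\<^sub>R s = a + b *\<^sub>R s + p \<and> copy_in f W' S k (a', b')"
          proof cases
            case 1
            \<comment> \<open>The translates of \<open>p\<close> based at
              \<open>a + b *\<^sub>R x\<close> for \<open>x \<in> S\<close> share the colour
              \<open>g p\<close>.\<close>
            have *: "a + p + b *\<^sub>R x = a + b *\<^sub>R x + p" for x by simp
            have "copy_in f W' S k (a + p, b)"
              unfolding copy_in_Pair * using 1 W'I[OF ab] p g by auto
            with D'3[OF ab p] * show ?thesis by blast
          next
            case 2
            then obtain a' b' where ab': "(a', b') \<in> D" "a' + b' *\<^sub>R s = p" "copy_in g W S k (a', b')"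
              using foc unfolding focused_def by blast
            \<comment> \<open>Each \<open>x \<in> S\<close> selects the point
              \<open>a' + b' *\<^sub>R x\<close> of the pattern in the translate of \<open>W\<close>
              based at \<open>a + b *\<^sub>R x\<close>.\<close>
            have *: "a + a' + (b + b') *\<^sub>R x = a + b *\<^sub>R x + (a' + b' *\<^sub>R x)" for x
              by (simp add: algebra_simps)
            have "copy_in f W' S k (a + a', b + b')"
              unfolding copy_in_Pair * using ab'(3) W'I[OF ab] g by (auto simp: copy_in_Pair)
            moreover have "a + a' + (b + b') *\<^sub>R s = a + b *\<^sub>R s + p"
              unfolding * ab'(2) ..
            ultimately show ?thesis using D'2[OF ab ab'(1)] by blast
          qed
        qed
        moreover have "insert (g p) K \<subseteq> {..<c}" using K gc by auto
        moreover have "card (insert (g p) K) = Suc r"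
          using K False by (simp add: finite_subset)
        ultimately show ?thesis by blast
      qed
    qed
  qed
  then show ?thesis by blast
qed

text \<open>After \<open>c\<close> focusing rounds the focused copies show all \<open>c\<close>
  colours, so one of them matches the focus.\<close>

lemma gallai_insert:
  assumes "gallai S" "finite S" "S \<noteq> {}"
  shows "gallai (insert s S)"
  unfolding gallai_def
proof
  fix c :: nat
  have "\<exists>W D. focusing S s c r W D" for r
  proof (induction r)
    case 0
    \<comment> \<open>With no colours to focus, any point serves as focus.\<close>
    have "focusing S s c 0 {0} {}"
      unfolding focusing_def focused_def by auto
    then show ?case by blast
  next
    case (Suc r)
    then show ?case using focusing_step assms by (metis ex_in_conv)
  qed
  then obtain W D where foc: "focusing S s c c W D" by blast
  show "\<exists>D. finite D \<and> (\<forall>(a, b)\<in>D. b > 0) \<and> (\<forall>f. f \<in> UNIV \<rightarrow> {..<c} \<longrightarrow>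
    (\<exists>(a, b)\<in>D. \<exists>k. \<forall>x\<in>insert s S. f (a + b *\<^sub>R x) = k))"
  proof (intro exI[of _ D] conjI allI impI)
    show "finite D" "\<forall>(a, b)\<in>D. b > 0" using foc by (simp_all add: focusing_def)
  next
    fix f :: "'a \<Rightarrow> nat" assume f: "f \<in> UNIV \<rightarrow> {..<c}"
    then consider ab k where "ab \<in> D" "copy_in f W (insert s S) k ab"
      | p K where "K \<subseteq> {..<c}" "card K = c" "focused f W D S s p K"
      using foc unfolding focusing_def by blast
    then show "\<exists>(a, b)\<in>D. \<exists>k. \<forall>x\<in>insert s S. f (a + b *\<^sub>R x) = k"
    proof cases
      case 1
      then show ?thesis by (cases ab) (force simp: copy_in_Pair)
    next
      case 2
      then have "K = {..<c}" by (simp add: card_subset_eq)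
      then have "f p \<in> K" using f by auto
      then obtain a b where "(a, b) \<in> D" "a + b *\<^sub>R s = p" "copy_in f W S (f p) (a, b)"
        using 2 unfolding focused_def by blast
      then show ?thesis by (force simp: copy_in_Pair)
    qed
  qed
qed

theorem gallai_finite:
  assumes "finite S" "S \<noteq> {}"
  shows "gallai S"
  using assms
proof (induction rule: finite_ne_induct)
  case (singleton x)
  show ?case
    unfolding gallai_def by (auto intro!: exI[of _ "{(0, 1)}"])
qed (simp add: gallai_insert)

text \<open>Finitely many nonzero distances have a positive minimum.\<close>

lemma finite_norm_gap:
  fixes T :: "'a::real_normed_vector set"
  assumes "finite T"
  obtains e where "e > 0" "\<And>x y. x \<in> T \<Longrightarrow> y \<in> T \<Longrightarrow> norm (x - y) < e \<Longrightarrow> x = y"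
proof -
  \<comment> \<open>The element 1 keeps \<open>N\<close> nonempty when \<open>T\<close> has at most
    one point.\<close>
  define N where "N = insert 1 ((\<lambda>(x, y). norm (x - y)) ` (T \<times> T) - {0})"
  have "finite N" unfolding N_def using assms by simp
  moreover have "\<forall>d\<in>N. d > 0" unfolding N_def by auto
  ultimately have "Min N > 0" by (simp add: N_def)
  moreover have "x = y" if "x \<in> T" "y \<in> T" "norm (x - y) < Min N" for x y
  proof (rule ccontr)
    assume "x \<noteq> y"
    with that have "norm (x - y) \<in> N" unfolding N_def by force
    with \<open>finite N\<close> that(3) show False by (meson Min_le not_le)
  qed
  ultimately show ?thesis using that by blast
qed

theorem theorem1p6:
  fixes S :: "(real^2) set" and c :: nat and f :: "real^2 \<Rightarrow> nat"
  assumes "finite S" and "S \<noteq> {}"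
    and "c \<ge> 1" and "f \<in> UNIV \<rightarrow> {1..c}"
  shows "\<exists>\<F> :: (real^2) set set.
           \<F> \<approx> Pow (UNIV :: nat set) \<and>
           pairwise disjnt \<F> \<and>
           (\<forall>X\<in>\<F>. monochromatic f X \<and> homothetic X S)"
proof -
  obtain D where D: "finite D" "\<And>a b. (a, b) \<in> D \<Longrightarrow> b > 0"
    and mono: "\<And>g. g \<in> UNIV \<rightarrow> {1..c} \<Longrightarrow>
      \<exists>a b k. (a, b) \<in> D \<and> (\<forall>x\<in>S. g (a + b *\<^sub>R x) = k)"
    using gallai_finite_colours[OF gallai_finite[OF assms(1,2)], of "{1..c}"]
    by (metis finite_atLeastAtMost)
  define T where "T = (\<lambda>((a, b), x). a + b *\<^sub>R x) ` (D \<times> S)"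
  have T: "a + b *\<^sub>R x \<in> T" if "(a, b) \<in> D" "x \<in> S" for a b x
    unfolding T_def using that by force
  have "finite T" unfolding T_def using D(1) assms(1) by simp
  then obtain e where e: "e > 0"
    and gap: "\<And>x y. x \<in> T \<Longrightarrow> y \<in> T \<Longrightarrow> norm (x - y) < e \<Longrightarrow> x = y"
    by (metis finite_norm_gap)
  define v :: "real^2" where "v = axis 1 1"
  have v: "norm v = 1" by (simp add: v_def)
  \<comment> \<open>Shifting the colouring by \<open>t *\<^sub>R v\<close> finds a copy in the
    translate of \<open>T\<close> by that vector; its homothety may vary with \<open>t\<close> but
    stays in \<open>D\<close>.\<close>
  have "\<exists>a b k. (a, b) \<in> D \<and> (\<forall>x\<in>S. f (t *\<^sub>R v + (a + b *\<^sub>R x)) = k)" for t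
    by (rule mono[of "\<lambda>y. f (t *\<^sub>R v + y)"]) (use assms(4) in auto)
  then obtain A B k where AB: "\<And>t. (A t, B t) \<in> D"
    and k: "\<And>t x. x \<in> S \<Longrightarrow> f (t *\<^sub>R v + (A t + B t *\<^sub>R x)) = k t"
    by metis
  define X where "X t = (\<lambda>x. (t *\<^sub>R v + A t) + B t *\<^sub>R x) ` S" for t
  have disj: "disjnt (X t) (X u)" if "t \<in> {0<..<e}" "u \<in> {0<..<e}" "t \<noteq> u" for t u
  proof (rule ccontr)
    assume "\<not> disjnt (X t) (X u)"
    then obtain x y where xy: "x \<in> S" "y \<in> S"
      and eq: "t *\<^sub>R v + A t + B t *\<^sub>R x = u *\<^sub>R v + A u + B u *\<^sub>R y"
      unfolding disjnt_def X_def by auto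
    \<comment> \<open>A common point makes \<open>(u - t) *\<^sub>R v\<close>, of norm below
      \<open>e\<close>, a difference of two points of \<open>T\<close>.\<close>
    have diff: "(A t + B t *\<^sub>R x) - (A u + B u *\<^sub>R y) = (u - t) *\<^sub>R v"
      using eq by (simp add: algebra_simps)
    then have "norm ((A t + B t *\<^sub>R x) - (A u + B u *\<^sub>R y)) < e"
      using that v by auto
    then have "A t + B t *\<^sub>R x = A u + B u *\<^sub>R y"
      by (rule gap[OF T[OF AB xy(1)] T[OF AB xy(2)]])
    then have "(u - t) *\<^sub>R v = 0"
      unfolding diff[symmetric] by simp
    with v that(3) show False by auto
  qed
  have ne: "X t \<noteq> {}" for t using assms(2) by (simp add: X_def)
  \<comment> \<open>Equal sets with distinct parameters would be disjoint from themselves, hence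
    empty.\<close>
  have "inj_on X {0<..<e}"
    using disj ne by (metis disjnt_self_iff_empty inj_onI)
  then have "X ` {0<..<e} \<approx> Pow (UNIV :: nat set)"
    unfolding Pow_UNIV using open_interval_eqpoll_reals[THEN iffD2, OF e] nat_sets_eqpoll_reals
    by (meson eqpoll_sym eqpoll_trans inj_on_image_eqpoll_self)
  moreover have "pairwise disjnt (X ` {0<..<e})"
    unfolding pairwise_def using disj by blast
  moreover have "monochromatic f (X t)" for t
    using k unfolding monochromatic_def X_def by (auto simp: add.assoc)
  moreover have "homothetic (X t) S" for t
    unfolding homothetic_def X_def using D(2)[OF AB, of t]
    by (intro exI[of _ "t *\<^sub>R v + A t"] exI[of _ "B t"]) simp
  ultimately show ?thesis by blast
qed

end
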